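(* Let $\mathit{Act}$ be a set of action labels (possibly containing $\tau$) and let $\mathit{int}\notin\mathit{Act}$ be an additional internal action label. For each $a\in\mathit{Act}\cup\{\mathit{int}\}$ let $E_a$ be a set. Consider a clustered linear process equation (the implementation) with set of states $D$ and initial state $d_0\in D$, $$X(d{:}D)=\sum_{a\in\mathit{Act}\cup\{\mathit{int}\}}\ \sum_{e_a\in E_a} c_a(d,e_a)\to a(f_a(d,e_a))\cdot X(g_a(d,e_a)),$$ and a predicate $\mathcal I$ on $D$ that is an invariant of $X$ (i.e. $\mathcal I(d)\wedge c_a(d,e_a)\Rightarrow \mathcal I(g_a(d,e_a))$ for all $a,d,e_a$) with $\mathcal I(d_0)$. Consider also a clustered linear process equation (the specification) with set of states $D'$ and initial state $d_0'\in D'$, $$Y(d'{:}D')=\sum_{a\in\mathit{Act}\cup\{\mathit{int}\}}\ \sum_{e_a\in E_a} c'_a(d',e_a)\to a(f'_a(d',e_a))\cdot Y(g'_a(d',e_a)).$$ Suppose there are a map $h:D\to D'$ (state mapping), a predicate $\mathit{FC}:D\to\mathbb B$ (focus condition), a well-founded ordering $<_M$ on $D$, and a map $p:D'\to\{\Delta,\nabla\}$ (cone labeling) such that $h(d_0)=d_0'$ and for every $d\in D$ with $\mathcal I(d)$ the following ten requirements hold: (I) if $\neg\mathit{FC}(d)$, then there is $e\in E_{\mathit{int}}$ with $c_{\mathit{int}}(d,e)$ and $g_{\mathit{int}}(d,e)<_M d$; (II) for all $e\in E_{\mathit{int}}$, $c_{\mathit{int}}(d,e)\Rightarrow h(d)=h(g_{\mathit{int}}(d,e))$;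 (III) for all $a\in\mathit{Act}$ and $e\in E_a$, if $\mathit{FC}(d)$ and $c'_a(h(d),e)$, then there is $d_{\mathit{int}}\in D$ with $d\xrightarrow{\mathit{int}}{}^{*} d_{\mathit{int}}$ and $c_a(d_{\mathit{int}},e)$; (IV) for all $a\in\mathit{Act}$ and $e\in E_a$, $c_a(d,e)\Rightarrow c'_a(h(d),e)$; (V) for all $a\in\mathit{Act}$ and $e\in E_a$, $c_a(d,e)\Rightarrow f_a(d,e)=f'_a(h(d),e)$; (VI) for all $a\in\mathit{Act}$ and $e\in E_a$, $c_a(d,e)\Rightarrow h(g_a(d,e))=g'_a(h(d),e)$; (I$_\Delta$) for all $e\in E_{\mathit{int}}$, $c'_{\mathit{int}}(h(d),e)\Rightarrow g'_{\mathit{int}}(h(d),e)=h(d)$; (II$_\Delta$) $p(h(d))=\Delta$ if and only if there is $e\in E_{\mathit{int}}$ with $c'_{\mathit{int}}(h(d),e)$; (III$_\Delta$) if $\mathit{FC}(d)$, then $p(h(d))=\Delta$ if and only if there is $e\in E_{\mathit{int}}$ with $c_{\mathit{int}}(d,e)$; (IV$_\Delta$) for all $e\in E_{\mathit{int}}$, if $p(h(d))=\nabla$ and $c_{\mathit{int}}(d,e)$, then $g_{\mathit{int}}(d,e)<_M d$. Then $X$ (with initial state $d_0$) and $Y$ (with initial state $d_0'$) are divergence-preserving branching bisimilar.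
   Context: A clustered linear process equation (LPE) has the form $Z(d{:}D)=\sum_{a}\sum_{e_a\in E_a} c_a(d,e_a)\to a(f_a(d,e_a))\cdot Z(g_a(d,e_a))$, where $D$ is a set of states, $a$ ranges over action labels, $c_a(d,e_a)$ is a boolean condition saying when action $a$ with parameter $f_a(d,e_a)$ is enabled in state $d$, and $g_a(d,e_a)$ is the resulting state. It determines transitions: $d\xrightarrow{l}d'$ iff there are $a$ and $e_a\in E_a$ with $l=a(f_a(d,e_a))$, $c_a(d,e_a)$ and $g_a(d,e_a)=d'$. For a label $l$, $d\xrightarrow{l}{}^{*}d'$ means there are finitely many states $d=d_0,\dots,d_k=d'$ ($k\ge 0$) with $d_i\xrightarrow{l}d_{i+1}$ for all $i<k$. The action $\mathit{int}$ is an internal (silent) action: transitions labeled $\mathit{int}$ are regarded as $\tau$-transitions, i.e. in the definition below "$\xrightarrow{\tau}$" refers to silent steps (labeled $\tau$ or $\mathit{int}$). A relation $R\subseteq D\times D'$ between the states of two LPEs is a divergence-preserving branching bisimulation iff for all $s\in D$, $t\in D'$ and labels $l$: (B1) if $sRt$ and $s\xrightarrow{l}s'$, then either $l=\tau$ and $s'Rt$, or there are $t',t''$ with $t\xrightarrow{\tau}{}^{*}t'\xrightarrow{l}t''$, $sRt'$ and $s'Rt''$; (B2) if $sRt$ and $t\xrightarrow{l}t'$, then either $l=\tau$ and $sRt'$, or there are $s',s''$ with $s\xrightarrow{\tau}{}^{*}s'\xrightarrow{l}s''$, $s'Rt$ and $s''Rt'$; (D1) if $sRt$ and there is an infinite sequence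 $(s_n)_{n\in\mathbb N}$ with $s_0=s$, $s_k\xrightarrow{\tau}s_{k+1}$ and $s_kRt$ for all $k$, then there is $t'$ with $t\xrightarrow{\tau}t'$ and $s_kRt'$ for some $k$; (D2) if $sRt$ and there is an infinite sequence $(t_n)_{n\in\mathbb N}$ with $t_0=t$, $t_k\xrightarrow{\tau}t_{k+1}$ and $sRt_k$ for all $k$, then there is $s'$ with $s\xrightarrow{\tau}s'$ and $s'Rt_k$ for some $k$. Two LPEs with initial states $d_0,d_0'$ are divergence-preserving branching bisimilar iff some such $R$ satisfies $d_0Rd_0'$. *)

theory Defs
  imports Main
begin

datatype 'a action = Tau | Internal | Name 'a

text \<open>
  A clustered linear process equation: \<open>lpe_cond X a d e\<close>, \<open>lpe_arg X a d e\<close> and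
  \<open>lpe_next X a d e\<close> are $c_a(d,e)$, $f_a(d,e)$ and $g_a(d,e)$. The set of states is the
  type \<open>'s\<close>. The types \<open>'e\<close> and \<open>'v\<close> are common to all actions; the sets
  $E_a$ are given by a separate function \<open>E\<close>, since two equations are to share them. The functions
  of the record are irrelevant outside the sums over \<open>a \<in> A\<close> and \<open>e \<in> E a\<close>.
\<close>

record ('a, 's, 'e, 'v) lpe =
  lpe_cond :: "'a action \<Rightarrow> 's \<Rightarrow> 'e \<Rightarrow> bool"
  lpe_arg :: "'a action \<Rightarrow> 's \<Rightarrow> 'e \<Rightarrow> 'v"
  lpe_next :: "'a action \<Rightarrow> 's \<Rightarrow> 'e \<Rightarrow> 's"

text \<open>The pair \<open>(a, v)\<close> is the label $a(v)$.\<close>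

type_synonym ('a, 'v) label = "'a action \<times> 'v"

definition lpe_trans ::
  "'a action set \<Rightarrow> ('a action \<Rightarrow> 'e set) \<Rightarrow> ('a, 's, 'e, 'v) lpe \<Rightarrow> 's \<Rightarrow> ('a, 'v) label \<Rightarrow> 's \<Rightarrow> bool"
where
  "lpe_trans A E X d l d' \<longleftrightarrow>
    (\<exists>a\<in>A. \<exists>e\<in>E a. l = (a, lpe_arg X a d e) \<and> lpe_cond X a d e \<and> lpe_next X a d e = d')"

text \<open>The internal action is silent, so the data argument its label carries is disregarded.\<close>

definition internal_step ::
  "'a action set \<Rightarrow> ('a action \<Rightarrow> 'e set) \<Rightarrow> ('a, 's, 'e, 'v) lpe \<Rightarrow> 's \<Rightarrow> 's \<Rightarrow> bool"
where
  "internal_step A E X d d' \<longleftrightarrow> (\<exists>v. lpe_trans A E X d (Internal, v) d')"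

definition lpe_invariant ::
  "'a action set \<Rightarrow> ('a action \<Rightarrow> 'e set) \<Rightarrow> ('a, 's, 'e, 'v) lpe \<Rightarrow> ('s \<Rightarrow> bool) \<Rightarrow> bool"
where
  "lpe_invariant A E X I \<longleftrightarrow>
    (\<forall>a\<in>A. \<forall>d. \<forall>e\<in>E a. I d \<and> lpe_cond X a d e \<longrightarrow> I (lpe_next X a d e))"

text \<open>
  Bisimilarity is defined on transition systems whose silent label is \<open>Silent\<close>. Labels with
  action \<open>Tau\<close> or \<open>Internal\<close> are both identified with it.
\<close>

datatype 'l observation = Silent | Visible 'l

fun observe :: "('a, 'v) label \<Rightarrow> ('a \<times> 'v) observation" where
  "observe (Tau, v) = Silent"
| "observe (Internal, v) = Silent"
| "observe (Name a, v) = Visible (a, v)"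

definition lpe_obs_trans ::
  "'a action set \<Rightarrow> ('a action \<Rightarrow> 'e set) \<Rightarrow> ('a, 's, 'e, 'v) lpe
    \<Rightarrow> 's \<Rightarrow> ('a \<times> 'v) observation \<Rightarrow> 's \<Rightarrow> bool"
where
  "lpe_obs_trans A E X d k d' \<longleftrightarrow> (\<exists>l. lpe_trans A E X d l d' \<and> observe l = k)"

definition dp_branching_bisimulation ::
  "('s \<Rightarrow> 'l observation \<Rightarrow> 's \<Rightarrow> bool) \<Rightarrow> ('t \<Rightarrow> 'l observation \<Rightarrow> 't \<Rightarrow> bool)
    \<Rightarrow> ('s \<Rightarrow> 't \<Rightarrow> bool) \<Rightarrow> bool"
where
  "dp_branching_bisimulation S T R \<longleftrightarrow>
    (\<forall>s t l s'. R s t \<and> S s l s' \<longrightarrow>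
       (l = Silent \<and> R s' t) \<or>
       (\<exists>t' t''. (\<lambda>x y. T x Silent y)\<^sup>*\<^sup>* t t' \<and> T t' l t'' \<and> R s t' \<and> R s' t'')) \<and>
    (\<forall>s t l t'. R s t \<and> T t l t' \<longrightarrow>
       (l = Silent \<and> R s t') \<or>
       (\<exists>s' s''. (\<lambda>x y. S x Silent y)\<^sup>*\<^sup>* s s' \<and> S s' l s'' \<and> R s' t \<and> R s'' t')) \<and>
    (\<forall>s t. \<forall>\<sigma> :: nat \<Rightarrow> 's.
       R s t \<and> \<sigma> 0 = s \<and> (\<forall>k. S (\<sigma> k) Silent (\<sigma> (Suc k)) \<and> R (\<sigma> k) t) \<longrightarrow>
       (\<exists>t'. T t Silent t' \<and> (\<exists>k. R (\<sigma> k) t'))) \<and>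
    (\<forall>s t. \<forall>\<theta> :: nat \<Rightarrow> 't.
       R s t \<and> \<theta> 0 = t \<and> (\<forall>k. T (\<theta> k) Silent (\<theta> (Suc k)) \<and> R s (\<theta> k)) \<longrightarrow>
       (\<exists>s'. S s Silent s' \<and> (\<exists>k. R s' (\<theta> k))))"

definition lpe_dp_branching_bisimilar ::
  "'a action set \<Rightarrow> ('a action \<Rightarrow> 'e set) \<Rightarrow> ('a, 's, 'e, 'v) lpe \<Rightarrow> 's \<Rightarrow> ('a, 't, 'e, 'v) lpe \<Rightarrow> 't
    \<Rightarrow> bool"
where
  "lpe_dp_branching_bisimilar A E X d Y d' \<longleftrightarrow>
    (\<exists>R. dp_branching_bisimulation (lpe_obs_trans A E X) (lpe_obs_trans A E Y) R \<and> R d d')"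

datatype cone_label = Delta | Nabla

end

(*
  The bisimulation relates each state d satisfying the invariant to h d. Internal steps do not
  change h, and well-foundedness gives a finite internal path from any state to a focus point,
  where steps of the specification with an action in Act can be matched. For divergence, an infinite silent
  sequence on which h is constant either contains a tau step, which the specification simulates
  directly, or consists of internal steps only; then the well-founded order excludes the label
  Nabla, and the label Delta provides an internal loop of the specification.
*)

theory Submission
  imports Defs
begin

lemma internal_step_iff:
  "internal_step A E X d d' \<longleftrightarrow>
    Internal \<in> A \<and> (\<exists>e\<in>E Internal. lpe_cond X Internal d e \<and> lpe_next X Internal d e = d')"
  by (auto simp: internal_step_def lpe_trans_def)

lemma lpe_obs_trans_iff:
  "lpe_obs_trans A E X d k d' \<longleftrightarrow>
    (\<exists>a\<in>A. \<exists>e\<in>E a. k = observe (a, lpe_arg X a d e) \<and> lpe_cond X a d e \<and> lpe_next X a d e = d')"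
  by (auto simp: lpe_obs_trans_def lpe_trans_def)

lemma lpe_obs_transI:
  "a \<in> A \<Longrightarrow> e \<in> E a \<Longrightarrow> lpe_cond X a d e \<Longrightarrow>
    lpe_obs_trans A E X d (observe (a, lpe_arg X a d e)) (lpe_next X a d e)"
  by (auto simp only: lpe_obs_trans_iff)

lemma lpe_obs_transE:
  assumes "lpe_obs_trans A E X d k d'"
  obtains a e where "a \<in> A" "e \<in> E a" "lpe_cond X a d e"
    "k = observe (a, lpe_arg X a d e)" "d' = lpe_next X a d e"
  using assms unfolding lpe_obs_trans_iff by blast

lemma internal_step_imp_silent:
  "internal_step A E X d d' \<Longrightarrow> lpe_obs_trans A E X d Silent d'"
  by (force simp: internal_step_iff lpe_obs_trans_iff)

lemma internal_steps_imp_silent_steps: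
  "(internal_step A E X)\<^sup>*\<^sup>* d d' \<Longrightarrow> (\<lambda>x y. lpe_obs_trans A E X x Silent y)\<^sup>*\<^sup>* d d'"
  by (erule rtranclp_mono[THEN predicate2D, rotated]) (auto intro: internal_step_imp_silent)

text \<open>Serves the divergence argument: no infinite run of internal steps can decrease at every
  step.\<close>

lemma wfp_no_descending_chain:
  assumes "wfp r"
  shows "\<exists>k::nat. \<not> r (\<sigma> (Suc k)) (\<sigma> k)"
  using assms unfolding wfp_def wf_iff_no_infinite_down_chain by auto

theorem theorem1:
  fixes Act :: "'a action set"
    and E :: "'a action \<Rightarrow> 'e set"
    and X :: "('a, 's, 'e, 'v) lpe" and d0 :: 's
    and Y :: "('a, 't, 'e, 'v) lpe" and d0' :: 't
    and I :: "'s \<Rightarrow> bool"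
    and h :: "'s \<Rightarrow> 't"
    and FC :: "'s \<Rightarrow> bool"
    and lessM :: "'s \<Rightarrow> 's \<Rightarrow> bool"
    and p :: "'t \<Rightarrow> cone_label"
  assumes "Internal \<notin> Act"
    and "lpe_invariant (insert Internal Act) E X I"
    and "I d0"
    and "transp lessM" and "wfp lessM"
    and "h d0 = d0'"
    and I: "\<And>d. I d \<Longrightarrow> \<not> FC d \<Longrightarrow>
      \<exists>e\<in>E Internal. lpe_cond X Internal d e \<and> lessM (lpe_next X Internal d e) d"
    and II: "\<And>d e. I d \<Longrightarrow> e \<in> E Internal \<Longrightarrow> lpe_cond X Internal d e \<Longrightarrow>
      h d = h (lpe_next X Internal d e)"
    and III: "\<And>d a e. I d \<Longrightarrow> a \<in> Act \<Longrightarrow> e \<in> E a \<Longrightarrow> FC d \<Longrightarrow> lpe_cond Y a (h d) e \<Longrightarrow>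
      \<exists>d_int. (internal_step (insert Internal Act) E X)\<^sup>*\<^sup>* d d_int \<and> lpe_cond X a d_int e"
    and IV: "\<And>d a e. I d \<Longrightarrow> a \<in> Act \<Longrightarrow> e \<in> E a \<Longrightarrow> lpe_cond X a d e \<Longrightarrow>
      lpe_cond Y a (h d) e"
    and V: "\<And>d a e. I d \<Longrightarrow> a \<in> Act \<Longrightarrow> e \<in> E a \<Longrightarrow> lpe_cond X a d e \<Longrightarrow>
      lpe_arg X a d e = lpe_arg Y a (h d) e"
    and VI: "\<And>d a e. I d \<Longrightarrow> a \<in> Act \<Longrightarrow> e \<in> E a \<Longrightarrow> lpe_cond X a d e \<Longrightarrow>
      h (lpe_next X a d e) = lpe_next Y a (h d) e"
    and I_Delta: "\<And>d e. I d \<Longrightarrow> e \<in> E Internal \<Longrightarrow> lpe_cond Y Internal (h d) e \<Longrightarrow>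
      lpe_next Y Internal (h d) e = h d"
    and II_Delta: "\<And>d. I d \<Longrightarrow>
      p (h d) = Delta \<longleftrightarrow> (\<exists>e\<in>E Internal. lpe_cond Y Internal (h d) e)"
    and III_Delta: "\<And>d. I d \<Longrightarrow> FC d \<Longrightarrow>
      p (h d) = Delta \<longleftrightarrow> (\<exists>e\<in>E Internal. lpe_cond X Internal d e)"
    and IV_Delta: "\<And>d e. I d \<Longrightarrow> e \<in> E Internal \<Longrightarrow> p (h d) = Nabla \<Longrightarrow> lpe_cond X Internal d e \<Longrightarrow>
      lessM (lpe_next X Internal d e) d"
  shows "lpe_dp_branching_bisimilar (insert Internal Act) E X d0 Y d0'"
proof -
  let ?A = "insert Internal Act"
  let ?X = "lpe_obs_trans ?A E X" and ?Y = "lpe_obs_trans ?A E Y"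
  let ?step = "internal_step ?A E X"
  define R where "R = (\<lambda>d t. I d \<and> h d = t)"
  have inv: "I (lpe_next X a d e)" if "I d" "a \<in> ?A" "e \<in> E a" "lpe_cond X a d e" for a d e
    using assms(2) that by (auto simp: lpe_invariant_def)
  have step: "I d' \<and> h d' = h d" if "?step d d'" "I d" for d d'
    using that inv[of d Internal] II[of d, symmetric] by (auto simp: internal_step_iff)
  have steps: "I d' \<and> h d' = h d" if "?step\<^sup>*\<^sup>* d d'" "I d" for d d'
    using that by (induction rule: rtranclp_induct) (auto dest: step)
  \<comment> \<open>Requirement \<open>I\<close> promises only that some internal step decreases.
    Under the label \<open>Nabla\<close> all of them do, whereas a state labelled
    \<open>Delta\<close> may lie on an internal cycle.\<close>
  have descend: "lessM d' d" if "?step d d'" "I d" "p (h d) = Nabla" for d d'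
    using that IV_Delta by (auto simp: internal_step_iff)
  have unfocused: "\<exists>d'. ?step d d' \<and> lessM d' d" if "I d" "\<not> FC d" for d
    using I[OF that] by (auto simp: internal_step_iff)
  have focus: "\<exists>d'. ?step\<^sup>*\<^sup>* d d' \<and> FC d'" if "I d" for d
    using \<open>wfp lessM\<close> that
  proof (induction d rule: wfp_induct_rule)
    case (less d)
    show ?case
    proof (cases "FC d")
      case False
      then obtain d1 where "?step d d1" "lessM d1 d"
        using unfocused less.prems by blast
      then obtain d' where "?step\<^sup>*\<^sup>* d1 d'" "FC d'"
        using less.IH step less.prems by blast
      then show ?thesis
        using \<open>?step d d1\<close> by (blast intro: converse_rtranclp_into_rtranclp)
    qed blast
  qed
  \<comment> \<open>Here \<open>a\<close> may be \<open>Tau\<close>, so silent steps are covered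
    too; \<open>D1\<close> relies on this.\<close>
  have forward: "?Y (h d) (observe (a, lpe_arg X a d e)) (h (lpe_next X a d e))"
    if "I d" "a \<in> Act" "e \<in> E a" "lpe_cond X a d e" for d a e
    using lpe_obs_transI[of a ?A e E Y] IV[OF that] V[OF that] VI[OF that] that by simp
  have backward: "\<exists>d' d''. ?step\<^sup>*\<^sup>* d d' \<and> ?X d' (observe (a, lpe_arg Y a (h d) e)) d''
      \<and> R d' (h d) \<and> R d'' (lpe_next Y a (h d) e)"
    if "I d" "a \<in> Act" "e \<in> E a" "lpe_cond Y a (h d) e" for d a e
  proof -
    \<comment> \<open>\<open>III\<close> speaks of focus points only, so the path first reaches one,
      \<open>d1\<close>, and then goes on to \<open>d2\<close>. As \<open>h\<close> is constant
      along it, the condition assumed at \<open>h d\<close> also holds at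
      \<open>h d1\<close>.\<close>
    obtain d1 where d1: "?step\<^sup>*\<^sup>* d d1" "FC d1"
      using focus \<open>I d\<close> by blast
    have Rd1: "I d1" "h d1 = h d"
      using steps d1 \<open>I d\<close> by auto
    obtain d2 where d2: "?step\<^sup>*\<^sup>* d1 d2" "lpe_cond X a d2 e"
      using III[OF Rd1(1) \<open>a \<in> Act\<close> \<open>e \<in> E a\<close> d1(2)] Rd1 \<open>lpe_cond Y a (h d) e\<close> by auto
    have Rd2: "I d2" "h d2 = h d"
      using steps[OF d2(1)] Rd1 by auto
    \<comment> \<open>\<open>III\<close> yields only that \<open>a\<close> is enabled at
      \<open>d2\<close> with the same \<open>e\<close>; since \<open>h d2 = h d\<close>,
      \<open>V\<close> identifies the label and \<open>VI\<close> the image of the target.\<close>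
    have "?X d2 (observe (a, lpe_arg Y a (h d) e)) (lpe_next X a d2 e)"
      using lpe_obs_transI[of a ?A e E X d2] V[OF Rd2(1) that(2,3) d2(2)] Rd2 d2 that by simp
    moreover have "R (lpe_next X a d2 e) (lpe_next Y a (h d) e)"
      using VI[OF Rd2(1) that(2,3) d2(2)] inv[of d2 a e] Rd2 d2 that by (auto simp: R_def)
    moreover have "?step\<^sup>*\<^sup>* d d2"
      using d1 d2 by (blast intro: rtranclp_trans)
    ultimately show ?thesis
      using Rd2 by (auto simp: R_def)
  qed
  have B1: "(l = Silent \<and> R d' t) \<or>
      (\<exists>t' t''. (\<lambda>x y. ?Y x Silent y)\<^sup>*\<^sup>* t t' \<and> ?Y t' l t'' \<and> R d t' \<and> R d' t'')"
    if Rdt: "R d t" and trans: "?X d l d'" for d t l d'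
  proof -
    obtain a e where ae: "a \<in> ?A" "e \<in> E a" "lpe_cond X a d e"
      and l: "l = observe (a, lpe_arg X a d e)" and d': "d' = lpe_next X a d e"
      using lpe_obs_transE[OF trans] by metis
    have d: "I d" "h d = t" "I d'"
      using that inv ae d' by (auto simp: R_def)
    show ?thesis
    \<comment> \<open>An internal step leaves \<open>h\<close> unchanged, so \<open>t\<close> need
      not move. Any other step is matched by \<open>t\<close> at once, after the empty silent
      path.\<close>
    proof (cases "a = Internal")
      case True
      then show ?thesis
        using II[OF d(1), of e, symmetric] ae d d' l by (auto simp: R_def)
    next
      case False
      then have "?Y t l (h d')"
        using forward[OF d(1)] ae d d' l by auto
      then show ?thesis
        using d by (auto simp: R_def)
    qed
  qed
  have B2: "(l = Silent \<and> R d t') \<or>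
      (\<exists>d' d''. (\<lambda>x y. ?X x Silent y)\<^sup>*\<^sup>* d d' \<and> ?X d' l d'' \<and> R d' t \<and> R d'' t')"
    if Rdt: "R d t" and trans: "?Y t l t'" for d t l t'
  proof -
    obtain a e where ae: "a \<in> ?A" "e \<in> E a" "lpe_cond Y a (h d) e"
      and l: "l = observe (a, lpe_arg Y a (h d) e)" and t': "t' = lpe_next Y a (h d) e"
      using lpe_obs_transE[OF trans] Rdt unfolding R_def by metis
    have d: "I d" "h d = t"
      using that by (auto simp: R_def)
    show ?thesis
    \<comment> \<open>By \<open>I_Delta\<close> an internal step of the specification at
      \<open>h d\<close> is a self-loop, so \<open>t' = t\<close> and \<open>d\<close> need not
      move.\<close>
    proof (cases "a = Internal")
      case True
      then show ?thesis
        using I_Delta[OF d(1)] ae d l t' by (auto simp: R_def)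
    next
      case False
      then obtain d' d'' where "?step\<^sup>*\<^sup>* d d'" "?X d' l d''" "R d' t" "R d'' t'"
        using backward[OF d(1) _ ae(2,3)] ae(1) d(2) l t' by auto
      then show ?thesis
        using internal_steps_imp_silent_steps by metis
    qed
  qed
  \<comment> \<open>In both cases the witness is \<open>t\<close> itself: a silent self-loop
    suffices, since every \<open>\<sigma> k\<close> is related to \<open>t\<close>.\<close>
  have D1: "\<exists>t'. ?Y t Silent t' \<and> (\<exists>k. R (\<sigma> k) t')"
    if \<sigma>: "\<And>k. ?X (\<sigma> k) Silent (\<sigma> (Suc k))" "\<And>k. R (\<sigma> k) t" for t and \<sigma> :: "nat \<Rightarrow> 's"
  proof (cases "\<forall>k. ?step (\<sigma> k) (\<sigma> (Suc k))")
    case True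
    have \<sigma>R: "I (\<sigma> k)" "h (\<sigma> k) = t" for k
      using \<sigma>(2)[of k] by (auto simp: R_def)
    have "p t \<noteq> Nabla"
    proof
      assume "p t = Nabla"
      \<comment> \<open>The label depends on the image under \<open>h\<close> only, so it is
        \<open>p t\<close> along the whole run.\<close>
      then have "lessM (\<sigma> (Suc k)) (\<sigma> k)" for k
        using descend True \<sigma>R by metis
      then show False
        using wfp_no_descending_chain[OF \<open>wfp lessM\<close>, of \<sigma>] by blast
    qed
    then have "p t = Delta"
      by (cases "p t") auto
    then obtain e where e: "e \<in> E Internal" "lpe_cond Y Internal t e"
      using II_Delta[OF \<sigma>R(1)[of 0]] \<sigma>R(2)[of 0] by auto
    then have "lpe_next Y Internal t e = t"
      using I_Delta[OF \<sigma>R(1)[of 0]] \<sigma>R(2)[of 0] by auto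
    then have "?Y t Silent t"
      using lpe_obs_transI[of Internal ?A e E Y t] e by simp
    then show ?thesis
      using \<sigma>(2) by blast
  next
    case False
    then obtain k where k: "\<not> ?step (\<sigma> k) (\<sigma> (Suc k))"
      by blast
    obtain a e where ae: "a \<in> ?A" "e \<in> E a" "lpe_cond X a (\<sigma> k) e"
      "observe (a, lpe_arg X a (\<sigma> k) e) = Silent" "lpe_next X a (\<sigma> k) e = \<sigma> (Suc k)"
      using lpe_obs_transE[OF \<sigma>(1)[of k]] by metis
    then have "a \<noteq> Internal"
      using k by (auto simp: internal_step_iff)
    \<comment> \<open>The action is silent but not \<open>Internal\<close>, hence
      \<open>Tau\<close>. Both ends of the step have image \<open>t\<close>, so
      \<open>forward\<close> gives a self-loop.\<close>
    then have "?Y t Silent t"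
      using forward[of "\<sigma> k" a e] ae \<sigma>(2)[of k] \<sigma>(2)[of "Suc k"] by (auto simp: R_def)
    then show ?thesis
      using \<sigma>(2) by blast
  qed
  \<comment> \<open>A self-loop is all that has to be treated: \<open>R\<close> relates
    \<open>d\<close> to \<open>h d\<close> only, so the infinite sequence in the definition is
    constantly \<open>t\<close>.\<close>
  have D2: "\<exists>d'. ?X d Silent d' \<and> R d' t" if Rdt: "R d t" and trans: "?Y t Silent t" for d t
  proof -
    have d: "I d" "h d = t"
      using that by (auto simp: R_def)
    show ?thesis
    proof (cases "\<exists>d'. ?step d d'")
      case True
      then obtain d' where "?step d d'"
        by blast
      then have "?X d Silent d'" "R d' t"
        using step d by (auto simp: R_def internal_step_imp_silent)
      then show ?thesis
        by blast
    next
      case False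
      \<comment> \<open>At a focus point without internal steps, \<open>III_Delta\<close> and
        \<open>II_Delta\<close> exclude an internal step of the specification at \<open>t\<close>,
        so the loop must be a \<open>Tau\<close> step.\<close>
      then have "FC d"
        using unfocused d by blast
      obtain a e where ae: "a \<in> ?A" "e \<in> E a" "lpe_cond Y a t e"
        "observe (a, lpe_arg Y a t e) = Silent" "lpe_next Y a t e = t"
        using lpe_obs_transE[OF trans] by metis
      have "p t \<noteq> Delta"
        using False III_Delta[OF \<open>I d\<close> \<open>FC d\<close>] d by (auto simp: internal_step_iff)
      then have "a \<noteq> Internal"
        using II_Delta[OF \<open>I d\<close>] ae d by auto
      then obtain d' d'' where "?step\<^sup>*\<^sup>* d d'" "?X d' Silent d''" "R d'' t"
        using backward[OF \<open>I d\<close>, of a e] ae d by auto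
      \<comment> \<open>The path given by \<open>backward\<close> consists of internal steps and
        none leaves \<open>d\<close>, so it is empty and the silent step starts at \<open>d\<close>
        itself.\<close>
      moreover from this have "d' = d"
        using False by (auto elim: converse_rtranclpE)
      ultimately show ?thesis
        by blast
    qed
  qed
  have "dp_branching_bisimulation ?X ?Y R"
    unfolding dp_branching_bisimulation_def
  proof (intro conjI allI impI; elim conjE)
    fix d t and \<sigma> :: "nat \<Rightarrow> 's"
    assume "\<forall>k. ?X (\<sigma> k) Silent (\<sigma> (Suc k)) \<and> R (\<sigma> k) t"
    then show "\<exists>t'. ?Y t Silent t' \<and> (\<exists>k. R (\<sigma> k) t')"
      by (intro D1) auto
  next
    fix d t and \<theta> :: "nat \<Rightarrow> 't"
    assume "R d t" and \<theta>: "\<forall>k. ?Y (\<theta> k) Silent (\<theta> (Suc k)) \<and> R d (\<theta> k)"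
    then have "\<theta> k = t" for k
      by (auto simp: R_def)
    then show "\<exists>d'. ?X d Silent d' \<and> (\<exists>k. R d' (\<theta> k))"
      using D2[OF \<open>R d t\<close>] \<theta> by simp
  qed (fact B1 B2)+
  moreover have "R d0 d0'"
    using assms(3,6) by (simp add: R_def)
  ultimately show ?thesis
    unfolding lpe_dp_branching_bisimilar_def by blast
qed

end
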